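(* Let $\mu,\mu'$ be probability measures on $\mathbb Z$ with supports $S_\mu\subset\mathbb Z^+$ and $S_{\mu'}\subset\mathbb Z^-$, and let $\xi_1,\xi_1'$ have laws $\mu,\mu'$. The measure $\lambda$ on $\mathbb R$ given by $$\lambda(dx)=\Big(\mathbf 1_{]-\infty,0[}(x)\,\mathbb P[\xi_1'<x]+\mathbf 1_{[0,+\infty[}(x)\,\mathbb P[\xi_1>x]\Big)dx,$$ where $dx$ is Lebesgue measure, is invariant for $\mathcal X^{(0)}(\mu,\mu')$ viewed as a Markov chain on $\mathbb R$.
   Context: $\mathbb Z^+$ (resp. $\mathbb Z^-$) is the set of positive (resp. negative) integers. The chain $\mathcal X^{(0)}(\mu,\mu')$ viewed on $\mathbb R$ has transition kernel $P(x,A)=\mathbb P[x+\xi_1\in A]$ if $x<0$ and $P(x,A)=\mathbb P[x+\xi_1'\in A]$ if $x\ge0$, for Borel $A\subset\mathbb R$. Invariance of $\lambda$ means $\int_{\mathbb R}P(x,A)\,\lambda(dx)=\lambda(A)$ for all Borel $A$. *)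

theory Defs
  imports "HOL-Probability.Probability"
begin

(* Transition kernel on the reals of the chain X^(0)(mu, mu'), where xi, xi' are random
   variables on M with laws mu, mu'.  The kernel depends only on these two laws, so no
   joint law or independence is needed; the start x = 0 moves by xi'. *)
definition oscillating_kernel ::
  "'a measure \<Rightarrow> ('a \<Rightarrow> int) \<Rightarrow> ('a \<Rightarrow> int) \<Rightarrow> real \<Rightarrow> real measure" where
  "oscillating_kernel M \<xi> \<xi>' x =
    (if x < 0 then distr M borel (\<lambda>\<omega>. x + real_of_int (\<xi> \<omega>))
     else distr M borel (\<lambda>\<omega>. x + real_of_int (\<xi>' \<omega>)))"

lemma emeasure_oscillating_kernel:
  assumes "\<xi> \<in> M \<rightarrow>\<^sub>M count_space UNIV" "\<xi>' \<in> M \<rightarrow>\<^sub>M count_space UNIV"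
    and "A \<in> sets borel"
  shows "emeasure (oscillating_kernel M \<xi> \<xi>' x) A =
    (if x < 0 then emeasure M {\<omega> \<in> space M. x + real_of_int (\<xi> \<omega>) \<in> A}
     else emeasure M {\<omega> \<in> space M. x + real_of_int (\<xi>' \<omega>) \<in> A})"
proof -
  have [measurable]: "(\<lambda>\<omega>. real_of_int (\<xi> \<omega>)) \<in> borel_measurable M"
    "(\<lambda>\<omega>. real_of_int (\<xi>' \<omega>)) \<in> borel_measurable M"
    using measurable_compose[OF assms(1), of real_of_int borel]
      measurable_compose[OF assms(2), of real_of_int borel] by auto
  show ?thesis
    using assms(3)
    by (auto simp: oscillating_kernel_def emeasure_distr vimage_def Int_def
        intro!: arg_cong[where f = "emeasure M"])
qed

lemma oscillating_kernel_measurable: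
  assumes "prob_space M"
    and "\<xi> \<in> M \<rightarrow>\<^sub>M count_space UNIV" "\<xi>' \<in> M \<rightarrow>\<^sub>M count_space UNIV"
  shows "oscillating_kernel M \<xi> \<xi>' \<in> borel \<rightarrow>\<^sub>M prob_algebra borel"
proof -
  have r [measurable]: "(\<lambda>\<omega>. real_of_int (\<xi> \<omega>)) \<in> borel_measurable M"
    "(\<lambda>\<omega>. real_of_int (\<xi>' \<omega>)) \<in> borel_measurable M"
    using measurable_compose[OF assms(2), of real_of_int borel]
      measurable_compose[OF assms(3), of real_of_int borel] by auto
  have M: "(\<lambda>_::real. M) \<in> borel \<rightarrow>\<^sub>M prob_algebra M"
    using assms(1) by (auto simp: space_prob_algebra)
  have "(\<lambda>x. distr M borel (\<lambda>\<omega>. x + real_of_int (\<xi> \<omega>))) \<in> borel \<rightarrow>\<^sub>M prob_algebra borel"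
    "(\<lambda>x. distr M borel (\<lambda>\<omega>. x + real_of_int (\<xi>' \<omega>))) \<in> borel \<rightarrow>\<^sub>M prob_algebra borel"
    by (rule measurable_distr_prob_space2[OF M]; measurable)+
  then show ?thesis
    unfolding oscillating_kernel_def[abs_def] by measurable
qed

(* L may be an infinite measure, so the identity is one between extended nonnegative reals. *)
definition invariant_measure :: "(real \<Rightarrow> real measure) \<Rightarrow> real measure \<Rightarrow> bool" where
  "invariant_measure P L \<longleftrightarrow>
    (\<forall>A \<in> sets borel. (\<integral>\<^sup>+ x. emeasure (P x) A \<partial>L) = emeasure L A)"

definition oscillating_lambda :: "'a measure \<Rightarrow> ('a \<Rightarrow> int) \<Rightarrow> ('a \<Rightarrow> int) \<Rightarrow> real measure" where
  "oscillating_lambda M \<xi> \<xi>' = density lborel (\<lambda>x. ennreal (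
     indicator {..<0} x * \<P>(\<omega> in M. real_of_int (\<xi>' \<omega>) < x)
   + indicator {0..} x * \<P>(\<omega> in M. real_of_int (\<xi> \<omega>) > x)))"

end

theory Submission
  imports Defs
begin

text \<open>For independent \<open>i\<close> and \<open>j\<close> with laws \<open>\<mu>\<close> and \<open>\<mu>'\<close>, the density of \<open>\<lambda>\<close> at \<open>x\<close> is the
  probability that \<open>x\<close> lies in \<open>]j, i[\<close>, up to the null set \<open>\<int>\<close>. One step of the chain translates
  \<open>]j, 0[\<close> by \<open>i\<close> and \<open>[0, i[\<close> by \<open>j\<close>, which gives \<open>]i + j, i[\<close> and \<open>[j, i + j[\<close>: an interval exchange
  of \<open>]j, i[\<close> up to null sets. Hence Lebesgue measure on \<open>]j, i[\<close> is preserved for each fixed pair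
  \<open>(i, j)\<close>, and averaging over the pair gives the invariance.\<close>

text \<open>Fubini needs joint measurability. As \<open>'b\<close> is countable, this can be checked
  slice by slice, so each \<open>f i\<close> being measurable is enough.\<close>

lemma nn_integral_measure_pmf_swap:
  fixes p :: "'b::countable pmf"
  assumes "sigma_finite_measure N" and f: "\<And>i. f i \<in> borel_measurable N"
  shows "(\<integral>\<^sup>+ x. \<integral>\<^sup>+ i. f i x \<partial>measure_pmf p \<partial>N) = (\<integral>\<^sup>+ i. \<integral>\<^sup>+ x. f i x \<partial>N \<partial>measure_pmf p)"
proof -
  interpret N: sigma_finite_measure N by fact
  interpret pair_sigma_finite "measure_pmf p" N ..
  have "(\<lambda>z. f (fst z) (snd z)) \<in> borel_measurable (count_space UNIV \<Otimes>\<^sub>M N)"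
    by (rule measurable_pair_measure_countable1) (use f in auto)
  then have "(\<lambda>z. f (fst z) (snd z)) \<in> borel_measurable (measure_pmf p \<Otimes>\<^sub>M N)"
    by (simp cong: measurable_cong_sets sets_pair_measure_cong)
  from Fubini'[of f, simplified case_prod_beta', OF this] show ?thesis
    by simp
qed

lemma nn_integral_lborel_indicator_translate:
  fixes A B :: "real set"
  assumes [measurable]: "A \<in> sets borel" "B \<in> sets borel"
  shows "(\<integral>\<^sup>+ x. indicator B x * indicator A (x + c) \<partial>lborel) =
    (\<integral>\<^sup>+ x. indicator B (x - c) * indicator A x \<partial>lborel)"
  \<comment> \<open>The \<open>lborel\<close> on the right is read as its own image under
    translation by \<open>c\<close>; the change of variables then turns \<open>x - c\<close> into
    \<open>x\<close>.\<close>
  by (subst (2) lborel_distr_plus[of c, symmetric]) (simp add: nn_integral_distr add.commute)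

lemma interval_exchange_lborel:
  fixes a b :: real
  assumes "a < 0" "0 < b" and [measurable]: "A \<in> sets borel"
  shows "(\<integral>\<^sup>+ x. indicator {a<..<0} x * indicator A (x + b) +
      indicator {0..<b} x * indicator A (x + a) \<partial>lborel) =
    (\<integral>\<^sup>+ x. indicator {a<..<b} x * indicator A x \<partial>lborel)"
proof -
  have ae: "AE x in lborel. x \<noteq> c" for c :: real
    by (rule AE_lborel_singleton)
  have "(\<integral>\<^sup>+ x. indicator {a<..<0} x * indicator A (x + b) +
      indicator {0..<b} x * indicator A (x + a) \<partial>lborel) =
    (\<integral>\<^sup>+ x. indicator {a<..<0} (x - b) * indicator A x +
      indicator {0..<b} (x - a) * indicator A x \<partial>lborel)"
    by (simp add: nn_integral_add nn_integral_lborel_indicator_translate)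
  \<comment> \<open>The translated pieces are \<open>{a + b<..<b}\<close> and
    \<open>{a..<a + b}\<close>. They are disjoint, and their union differs from
    \<open>{a<..<b}\<close> only at \<open>a\<close> and \<open>a + b\<close>.\<close>
  also have "\<dots> = (\<integral>\<^sup>+ x. indicator {a<..<b} x * indicator A x \<partial>lborel)"
    using ae[of a] ae[of "a + b"] assms(1,2)
    by (intro nn_integral_cong_AE) (auto elim!: AE_mp split: split_indicator)
  finally show ?thesis .
qed

lemma nn_integral_pair_pmf_mult:
  "(\<integral>\<^sup>+ z. f (fst z) * g (snd z) \<partial>measure_pmf (pair_pmf p q)) =
    (\<integral>\<^sup>+ i. f i \<partial>measure_pmf p) * (\<integral>\<^sup>+ j. g j \<partial>measure_pmf q)"
  by (simp add: nn_integral_pair_pmf' nn_integral_cmult nn_integral_multc)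

theorem lemma2p4:
  fixes \<mu> \<mu>' :: "int pmf" and M :: "'a measure" and \<xi> \<xi>' :: "'a \<Rightarrow> int"
  assumes "set_pmf \<mu> \<subseteq> {0<..}"
    and "set_pmf \<mu>' \<subseteq> {..<0}"
    and "prob_space M"
    and "\<xi> \<in> M \<rightarrow>\<^sub>M count_space UNIV"
    and "\<xi>' \<in> M \<rightarrow>\<^sub>M count_space UNIV"
    and "distr M (count_space UNIV) \<xi> = measure_pmf \<mu>"
    and "distr M (count_space UNIV) \<xi>' = measure_pmf \<mu>'"
  shows "invariant_measure (oscillating_kernel M \<xi> \<xi>') (oscillating_lambda M \<xi> \<xi>')"
  unfolding invariant_measure_def
proof
  fix A :: "real set"
  assume A [measurable]: "A \<in> sets borel"
  interpret prob_space M by fact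
  \<comment> \<open>This independent coupling need not be the joint law of \<open>\<xi>\<close> and
    \<open>\<xi>'\<close> under \<open>M\<close>. It can replace it because kernel and density
    involve only the two marginals.\<close>
  let ?E = "measure_pmf (pair_pmf \<mu> \<mu>')"
  define d where "d x = ennreal (indicator {..<0} x * \<P>(\<omega> in M. real_of_int (\<xi>' \<omega>) < x)
    + indicator {0..} x * \<P>(\<omega> in M. real_of_int (\<xi> \<omega>) > x))" for x :: real
  have law: "emeasure M {\<omega> \<in> space M. Q (\<xi> \<omega>)} = emeasure (measure_pmf \<mu>) {i. Q i}"
    "emeasure M {\<omega> \<in> space M. Q (\<xi>' \<omega>)} = emeasure (measure_pmf \<mu>') {i. Q i}" for Q
    unfolding assms(6,7)[symmetric] using assms(4,5)
    by (auto simp: emeasure_distr vimage_def Int_def conj_commute)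
  have d_eq: "d x = (if x < 0 then emeasure (measure_pmf \<mu>') {j. real_of_int j < x}
      else emeasure (measure_pmf \<mu>) {i. x < real_of_int i})" for x
    using law(1)[of "\<lambda>i. x < real_of_int i"] law(2)[of "\<lambda>j. real_of_int j < x"]
    by (auto simp: d_def emeasure_eq_measure)
  have kernel: "emeasure (oscillating_kernel M \<xi> \<xi>' x) A =
      (if x < 0 then emeasure (measure_pmf \<mu>) {i. x + real_of_int i \<in> A}
       else emeasure (measure_pmf \<mu>') {j. x + real_of_int j \<in> A})" for x
    using law(1)[of "\<lambda>i. x + real_of_int i \<in> A"] law(2)[of "\<lambda>j. x + real_of_int j \<in> A"]
    by (simp add: emeasure_oscillating_kernel[OF assms(4,5) A])
  have d_meas [measurable]: "d \<in> borel_measurable lborel"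
  proof -
    \<comment> \<open>Both probabilities are monotone in \<open>x\<close>, hence Borel; the second
      decreases, so its negative is treated.\<close>
    have "(\<lambda>x. \<P>(\<omega> in M. real_of_int (\<xi>' \<omega>) < x)) \<in> borel_measurable borel"
      by (intro borel_measurable_mono monoI finite_measure_mono)
        (use assms(5) in \<open>auto intro: measurable_compose[OF _ measurable_count_space]\<close>)
    moreover have "(\<lambda>x. - \<P>(\<omega> in M. x < real_of_int (\<xi> \<omega>))) \<in> borel_measurable borel"
      by (intro borel_measurable_mono monoI le_imp_neg_le finite_measure_mono) (use assms(4) in auto)
    ultimately show ?thesis unfolding d_def
      by simp
  qed
  have kernel_meas [measurable]:
    "(\<lambda>x. emeasure (oscillating_kernel M \<xi> \<xi>' x) A) \<in> borel_measurable lborel"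
    using measurable_emeasure_kernel[OF measurable_prob_algebraD[OF
      oscillating_kernel_measurable[OF assms(3-5)]] A] by simp
  have \<lambda>: "oscillating_lambda M \<xi> \<xi>' = density lborel d"
    by (simp add: oscillating_lambda_def d_def[abs_def])
  \<comment> \<open>On each side of 0 the density involves one of the two laws and the kernel the
    other, so their product is a single expectation over an independent pair.\<close>
  have step: "d x * emeasure (oscillating_kernel M \<xi> \<xi>' x) A =
      (\<integral>\<^sup>+ (i, j). indicator {real_of_int j<..<0} x * indicator A (x + real_of_int i) +
        indicator {0..<real_of_int i} x * indicator A (x + real_of_int j) \<partial>?E)" for x
  proof (cases "x < 0")
    case True
    have "d x * emeasure (oscillating_kernel M \<xi> \<xi>' x) A =
        emeasure (measure_pmf \<mu>) {i. x + real_of_int i \<in> A} *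
          emeasure (measure_pmf \<mu>') {j. real_of_int j < x}"
      using True by (simp add: d_eq kernel mult.commute)
    also have "\<dots> = (\<integral>\<^sup>+ z. indicator {i. x + real_of_int i \<in> A} (fst z) *
        indicator {j. real_of_int j < x} (snd z) \<partial>?E)"
      by (subst nn_integral_pair_pmf_mult) simp
    finally show ?thesis
      using True by (auto intro!: nn_integral_cong split: split_indicator)
  next
    case False
    have "d x * emeasure (oscillating_kernel M \<xi> \<xi>' x) A =
        emeasure (measure_pmf \<mu>) {i. x < real_of_int i} *
          emeasure (measure_pmf \<mu>') {j. x + real_of_int j \<in> A}"
      using False by (simp add: d_eq kernel)
    also have "\<dots> = (\<integral>\<^sup>+ z. indicator {i. x < real_of_int i} (fst z) *
        indicator {j. x + real_of_int j \<in> A} (snd z) \<partial>?E)"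
      by (subst nn_integral_pair_pmf_mult) simp
    finally show ?thesis
      using False by (auto intro!: nn_integral_cong split: split_indicator)
  qed
  have d_pair: "d x = (\<integral>\<^sup>+ (i, j). indicator {real_of_int j<..<real_of_int i} x \<partial>?E)" for x
  proof (cases "x < 0")
    case True
    have "d x = (\<integral>\<^sup>+ z. 1 * indicator {j. real_of_int j < x} (snd z) \<partial>?E)"
      using True by (subst nn_integral_pair_pmf_mult) (simp add: d_eq)
    \<comment> \<open>The added constraint \<open>x < i\<close> holds almost surely, since
      \<open>x < 0 < i\<close>.\<close>
    also have "\<dots> = (\<integral>\<^sup>+ (i, j). indicator {real_of_int j<..<real_of_int i} x \<partial>?E)"
      using True assms(1)
      by (intro nn_integral_cong_AE) (force simp: AE_measure_pmf_iff split: split_indicator)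
    finally show ?thesis .
  next
    case False
    have "d x = (\<integral>\<^sup>+ z. indicator {i. x < real_of_int i} (fst z) * 1 \<partial>?E)"
      using False by (subst nn_integral_pair_pmf_mult) (simp add: d_eq)
    \<comment> \<open>Symmetrically, \<open>j < 0 \<le> x\<close> almost surely.\<close>
    also have "\<dots> = (\<integral>\<^sup>+ (i, j). indicator {real_of_int j<..<real_of_int i} x \<partial>?E)"
      using False assms(2)
      by (intro nn_integral_cong_AE) (force simp: AE_measure_pmf_iff split: split_indicator)
    finally show ?thesis .
  qed
  have "(\<integral>\<^sup>+ x. emeasure (oscillating_kernel M \<xi> \<xi>' x) A \<partial>oscillating_lambda M \<xi> \<xi>') =
      (\<integral>\<^sup>+ x. d x * emeasure (oscillating_kernel M \<xi> \<xi>' x) A \<partial>lborel)"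
    unfolding \<lambda> by (rule nn_integral_density) measurable
  also have "\<dots> = (\<integral>\<^sup>+ z. \<integral>\<^sup>+ x. (case z of (i, j) \<Rightarrow>
      indicator {real_of_int j<..<0} x * indicator A (x + real_of_int i) +
      indicator {0..<real_of_int i} x * indicator A (x + real_of_int j)) \<partial>lborel \<partial>?E)"
    unfolding step by (rule nn_integral_measure_pmf_swap)
      (auto simp: lborel.sigma_finite_measure_axioms split: prod.split)
  \<comment> \<open>With the Lebesgue integral now inside, the interval exchange applies to each
    pair separately; the supports give \<open>j < 0 < i\<close> almost surely.\<close>
  also have "\<dots> = (\<integral>\<^sup>+ z. \<integral>\<^sup>+ x. (case z of (i, j) \<Rightarrow>
      indicator {real_of_int j<..<real_of_int i} x) * indicator A x \<partial>lborel \<partial>?E)"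
    using assms(1,2) interval_exchange_lborel[OF _ _ A]
    by (intro nn_integral_cong_AE) (force simp: AE_measure_pmf_iff)
  \<comment> \<open>Swapping back puts the average over pairs inside, where it is \<open>d x\<close>
    again.\<close>
  also have "\<dots> = (\<integral>\<^sup>+ x. \<integral>\<^sup>+ z. (case z of (i, j) \<Rightarrow>
      indicator {real_of_int j<..<real_of_int i} x) * indicator A x \<partial>?E \<partial>lborel)"
    by (rule nn_integral_measure_pmf_swap[symmetric])
      (auto simp: lborel.sigma_finite_measure_axioms split: prod.split)
  also have "\<dots> = (\<integral>\<^sup>+ x. d x * indicator A x \<partial>lborel)"
    by (simp add: d_pair nn_integral_multc)
  also have "\<dots> = emeasure (oscillating_lambda M \<xi> \<xi>') A"
    unfolding \<lambda> by (rule emeasure_density[symmetric]) auto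
  finally show "(\<integral>\<^sup>+ x. emeasure (oscillating_kernel M \<xi> \<xi>' x) A
      \<partial>oscillating_lambda M \<xi> \<xi>') = emeasure (oscillating_lambda M \<xi> \<xi>') A" .
qed

end
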